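(* Let $\omega$ be a non-periodic regular Toeplitz sequence (over a finite alphabet $A$, indexed by $\mathbb{I}=\mathbb{N}_0$ or $\mathbb{I}=\mathbb{Z}$) with weak periodic structure $(p_\ell)_{\ell\in\mathbb{N}}$. Then $$\overline{\mathrm{ac}}\big(\sigma|_{\Sigma_\omega}\big)\ \le\ \limsup_{\ell\to\infty}\frac{\log p_{\ell+1}}{-\log(1-D(p_\ell))}.$$
   Context: Amorphic complexity. Let $(X,d)$ be a metric space and $f:X\to X$. For $x,y\in X$, $\delta>0$, $n\in\mathbb{N}$ let $S_n(f,\delta,x,y)=\#\{0\le k<n \mid d(f^k(x),f^k(y))\ge\delta\}$. For $\nu\in(0,1]$, points $x,y$ are $(f,\delta,\nu)$-separated if $\limsup_{n\to\infty} S_n(f,\delta,x,y)/n\ge\nu$. A subset is $(f,\delta,\nu)$-separated if all pairs of distinct points of it are. $\operatorname{Sep}(f,\delta,\nu)$ is the largest cardinality (possibly $\infty$) of an $(f,\delta,\nu)$-separated subset of $X$. The upper amorphic complexity is $\overline{\mathrm{ac}}(f)=\sup_{\delta>0}\limsup_{\nu\to0}\frac{\log\operatorname{Sep}(f,\delta,\nu)}{-\log\nu}$. Toeplitz sequences. Let $A$ be a finite alphabet, $\mathbb{I}=\mathbb{N}_0$ or $\mathbb{Z}$; $A^{\mathbb{I}}$ carries the metric $\rho(x,y)=2^{-j}$, $j=\min\{|k| : k\in\mathbb{I},\, x_k\ne y_k\}$ for $x\ne y$, and $\sigma$ is the left shift. A sequence $\omega=(\omega_k)_{k\in\mathbb{I}}\in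 A^{\mathbb{I}}$ is Toeplitz if for all $k\in\mathbb{I}$ there is $p\in\mathbb{N}$ with $\omega_{k+p\ell}=\omega_k$ for all $\ell\in\mathbb{N}$. $\Sigma_\omega$ is the shift orbit closure of $\omega$. For $p\in\mathbb{N}$, $p\geq 1$, put $\operatorname{Per}(p,\omega)=\{k\in\mathbb{I}\mid \omega_{k+p\ell}=\omega_k \text{ for all }\ell\in\mathbb{N}\}$ and $D(p)=\#(\operatorname{Per}(p,\omega)\cap[0,p-1])/p$. A weak periodic structure for $\omega$ is a sequence $(p_\ell)_{\ell\in\mathbb{N}}$ of positive integers such that $p_{\ell+1}$ is a multiple of $p_\ell$ for all $\ell$ and $\bigcup_{\ell\in\mathbb{N}}\operatorname{Per}(p_\ell,\omega)=\mathbb{I}$. The Toeplitz sequence $\omega$ is regular if $\lim_{\ell\to\infty}D(p_\ell)=1$ for a weak periodic structure $(p_\ell)$ of $\omega$ (this does not depend on the chosen weak periodic structure). *)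

theory Defs
  imports "HOL-Analysis.Analysis"
begin

section \<open>Amorphic complexity\<close>

text \<open>The space is a carrier set \<open>X\<close> with a distance \<open>d\<close>; only the values of \<open>f\<close> on the orbits
  of points of \<open>X\<close> enter.\<close>

definition sep_count ::
  "('x \<Rightarrow> 'x \<Rightarrow> real) \<Rightarrow> ('x \<Rightarrow> 'x) \<Rightarrow> real \<Rightarrow> 'x \<Rightarrow> 'x \<Rightarrow> nat \<Rightarrow> nat" where
  "sep_count d f \<delta> x y n = card {k. k < n \<and> d ((f ^^ k) x) ((f ^^ k) y) \<ge> \<delta>}"

definition separated_points ::
  "('x \<Rightarrow> 'x \<Rightarrow> real) \<Rightarrow> ('x \<Rightarrow> 'x) \<Rightarrow> real \<Rightarrow> real \<Rightarrow> 'x \<Rightarrow> 'x \<Rightarrow> bool" where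
  "separated_points d f \<delta> \<nu> x y \<longleftrightarrow>
     limsup (\<lambda>n. ereal (real (sep_count d f \<delta> x y n) / real n)) \<ge> ereal \<nu>"

definition separated_set ::
  "('x \<Rightarrow> 'x \<Rightarrow> real) \<Rightarrow> ('x \<Rightarrow> 'x) \<Rightarrow> real \<Rightarrow> real \<Rightarrow> 'x set \<Rightarrow> bool" where
  "separated_set d f \<delta> \<nu> S \<longleftrightarrow> (\<forall>x\<in>S. \<forall>y\<in>S. x \<noteq> y \<longrightarrow> separated_points d f \<delta> \<nu> x y)"

definition ecard :: "'x set \<Rightarrow> enat" where
  "ecard S = (if finite S then enat (card S) else \<infinity>)"

definition Sep ::
  "'x set \<Rightarrow> ('x \<Rightarrow> 'x \<Rightarrow> real) \<Rightarrow> ('x \<Rightarrow> 'x) \<Rightarrow> real \<Rightarrow> real \<Rightarrow> enat" where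
  "Sep X d f \<delta> \<nu> = (SUP S\<in>{S. S \<subseteq> X \<and> separated_set d f \<delta> \<nu> S}. ecard S)"

definition eln :: "enat \<Rightarrow> ereal" where
  "eln N = (case N of enat m \<Rightarrow> if m = 0 then -\<infinity> else ereal (ln (real m)) | \<infinity> \<Rightarrow> \<infinity>)"

definition upper_ac :: "'x set \<Rightarrow> ('x \<Rightarrow> 'x \<Rightarrow> real) \<Rightarrow> ('x \<Rightarrow> 'x) \<Rightarrow> ereal" where
  "upper_ac X d f =
     (SUP \<delta>\<in>{0<..}. Limsup (at_right 0) (\<lambda>\<nu>. eln (Sep X d f \<delta> \<nu>) / ereal (- ln \<nu>)))"

section \<open>Symbolic dynamics\<close>

text \<open>The index set \<open>I\<close> is the set of nonnegative integers or all of \<open>\<int>\<close>, taken as a set of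
  integers to treat both cases at once. Sequences indexed by \<open>I\<close> are extensional
  functions on \<open>I\<close>, so that equality of functions is equality of sequences.\<close>

definition full_shift :: "int set \<Rightarrow> 'a set \<Rightarrow> (int \<Rightarrow> 'a) set" where
  "full_shift I A = I \<rightarrow>\<^sub>E A"

definition seq_dist :: "int set \<Rightarrow> (int \<Rightarrow> 'a) \<Rightarrow> (int \<Rightarrow> 'a) \<Rightarrow> real" where
  "seq_dist I x y =
     (if x = y then 0 else (1/2) ^ (LEAST j. \<exists>k\<in>I. nat \<bar>k\<bar> = j \<and> x k \<noteq> y k))"

lemma Metric_space_full_shift: "Metric_space (full_shift I A) (seq_dist I)"
proof
  fix x y z :: "int \<Rightarrow> 'a"
  let ?j = "\<lambda>x y. LEAST j. \<exists>k\<in>I. nat \<bar>k\<bar> = j \<and> x k \<noteq> (y k :: 'a)"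
  show "0 \<le> seq_dist I x y" by (simp add: seq_dist_def)
  show "seq_dist I x y = seq_dist I y x"
    by (simp add: seq_dist_def eq_commute[of x y] eq_commute[of "x _"])
  show "seq_dist I x y = 0 \<longleftrightarrow> x = y" by (simp add: seq_dist_def)
  assume xyz: "x \<in> full_shift I A" "y \<in> full_shift I A" "z \<in> full_shift I A"
  show "seq_dist I x z \<le> seq_dist I x y + seq_dist I y z"
  proof (cases "x = y \<or> y = z \<or> x = z")
    case True
    then show ?thesis by (auto simp: seq_dist_def)
  next
    case False
    then obtain k0 where "k0 \<in> I" "x k0 \<noteq> z k0"
      using xyz unfolding full_shift_def by (metis PiE_ext)
    then have "\<exists>k\<in>I. nat \<bar>k\<bar> = ?j x z \<and> x k \<noteq> z k"
      by (intro LeastI_ex[where P = "\<lambda>j. \<exists>k\<in>I. nat \<bar>k\<bar> = j \<and> x k \<noteq> z k"]) blast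
    then obtain k where k: "k \<in> I" "nat \<bar>k\<bar> = ?j x z" "x k \<noteq> z k" by blast
    have "?j x y \<le> ?j x z \<or> ?j y z \<le> ?j x z"
    proof (cases "x k = y k")
      case True
      with k have "y k \<noteq> z k" by simp
      with k have "?j y z \<le> ?j x z" by (intro Least_le) blast
      then show ?thesis ..
    next
      case False
      with k have "?j x y \<le> ?j x z" by (intro Least_le) blast
      then show ?thesis ..
    qed
    then have "(1/2::real) ^ ?j x z \<le> (1/2) ^ ?j x y \<or> (1/2::real) ^ ?j x z \<le> (1/2) ^ ?j y z"
      by (auto intro: power_decreasing)
    moreover have "(0::real) \<le> (1/2) ^ ?j x y" "(0::real) \<le> (1/2) ^ ?j y z" by simp_all
    ultimately have "(1/2::real) ^ ?j x z \<le> (1/2) ^ ?j x y + (1/2) ^ ?j y z" by linarith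
    with False show ?thesis by (simp add: seq_dist_def)
  qed
qed

definition translate :: "int set \<Rightarrow> int \<Rightarrow> (int \<Rightarrow> 'a) \<Rightarrow> (int \<Rightarrow> 'a)" where
  "translate I m x = (\<lambda>k\<in>I. x (k + m))"

abbreviation shift :: "int set \<Rightarrow> (int \<Rightarrow> 'a) \<Rightarrow> (int \<Rightarrow> 'a)" where
  "shift I \<equiv> translate I 1"

text \<open>Letting \<open>m\<close> range over \<open>I\<close> gives the forward orbit for the one-sided shift and the full
  orbit for the (invertible) two-sided shift.\<close>

definition orbit_closure :: "int set \<Rightarrow> 'a set \<Rightarrow> (int \<Rightarrow> 'a) \<Rightarrow> (int \<Rightarrow> 'a) set" where
  "orbit_closure I A \<omega> =
     Metric_space.mtopology (full_shift I A) (seq_dist I) closure_of {translate I m \<omega> | m. m \<in> I}"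

section \<open>Toeplitz sequences\<close>

definition Per :: "int set \<Rightarrow> nat \<Rightarrow> (int \<Rightarrow> 'a) \<Rightarrow> int set" where
  "Per I p \<omega> = {k\<in>I. \<forall>l::nat. \<omega> (k + int p * int l) = \<omega> k}"

definition toeplitz :: "int set \<Rightarrow> (int \<Rightarrow> 'a) \<Rightarrow> bool" where
  "toeplitz I \<omega> \<longleftrightarrow> (\<forall>k\<in>I. \<exists>p::nat. p \<ge> 1 \<and> (\<forall>l::nat. \<omega> (k + int p * int l) = \<omega> k))"

definition periodic_seq :: "int set \<Rightarrow> (int \<Rightarrow> 'a) \<Rightarrow> bool" where
  "periodic_seq I \<omega> \<longleftrightarrow> (\<exists>p::nat. p \<ge> 1 \<and> (\<forall>k\<in>I. \<omega> (k + int p) = \<omega> k))"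

definition per_density :: "int set \<Rightarrow> (int \<Rightarrow> 'a) \<Rightarrow> nat \<Rightarrow> real" where
  "per_density I \<omega> p = real (card (Per I p \<omega> \<inter> {0..int p - 1})) / real p"

definition weak_periodic_structure :: "int set \<Rightarrow> (int \<Rightarrow> 'a) \<Rightarrow> (nat \<Rightarrow> nat) \<Rightarrow> bool" where
  "weak_periodic_structure I \<omega> p \<longleftrightarrow>
     (\<forall>l. p l \<ge> 1) \<and> (\<forall>l. p l dvd p (Suc l)) \<and> (\<Union>l. Per I (p l) \<omega>) = I"

definition regular_toeplitz :: "int set \<Rightarrow> (int \<Rightarrow> 'a) \<Rightarrow> bool" where
  "regular_toeplitz I \<omega> \<longleftrightarrow> toeplitz I \<omega> \<and>
     (\<exists>p. weak_periodic_structure I \<omega> p \<and> (\<lambda>l. per_density I \<omega> (p l)) \<longlonglongrightarrow> 1)"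

end

(* For a fixed period p, every point of the orbit closure carries a residue mod p, and two points
   with the same residue disagree only on a translate of the p-periodic hole set of the Toeplitz
   sequence, whose density is 1 - D(p). A distance of at least delta only sees a window of
   some bounded length C, so points with equal residues are not separated at level nu as soon as
   C (1 - D(p)) < nu, and then Sep is at most p. Taking p = p_(l+1) for the least index at which
   this holds, C (1 - D(p_l)) >= nu, and Sep <= p_(l+1) becomes the stated bound. *)
theory Submission
  imports Defs
begin

section \<open>Distances, finite windows and iterates of the shift\<close>

lemma seq_dist_lessD:
  assumes "seq_dist I x y < (1/2) ^ N" "k \<in> I" "nat \<bar>k\<bar> \<le> N"
  shows "x k = y k"
proof (rule ccontr)
  assume ne: "x k \<noteq> y k"
  let ?j = "LEAST j. \<exists>k\<in>I. nat \<bar>k\<bar> = j \<and> x k \<noteq> y k"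
  have "?j \<le> nat \<bar>k\<bar>" using ne assms(2) by (intro Least_le) blast
  then have "(1/2::real) ^ N \<le> (1/2) ^ ?j" using assms(3) by (intro power_decreasing) auto
  moreover have "x \<noteq> y" using ne by auto
  ultimately show False using assms(1) by (simp add: seq_dist_def)
qed

text \<open>Turns separation at a scale above \<open>(1/2) ^ M\<close> into a disagreement inside
  the fixed window of indices of modulus below \<open>M\<close>. Extensionality ensures that two
  different functions already differ on \<open>I\<close>.\<close>

lemma seq_dist_gtE:
  assumes "(1/2) ^ M < seq_dist I x y" "x \<in> extensional I" "y \<in> extensional I"
  obtains k where "k \<in> I" "\<bar>k\<bar> < int M" "x k \<noteq> y k"
proof -
  let ?P = "\<lambda>j. \<exists>k\<in>I. nat \<bar>k\<bar> = j \<and> x k \<noteq> y k"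
  have "0 < (1/2::real) ^ M" by simp
  with assms(1) have ne: "x \<noteq> y" by (auto simp: seq_dist_def)
  then obtain k0 where "k0 \<in> I" "x k0 \<noteq> y k0"
    using assms(2,3) by (metis extensionalityI)
  then have "?P (LEAST j. ?P j)" by (intro LeastI_ex[where P = ?P]) blast
  then obtain k where k: "k \<in> I" "nat \<bar>k\<bar> = (LEAST j. ?P j)" "x k \<noteq> y k" by blast
  have "(1/2::real) ^ M < (1/2) ^ (LEAST j. ?P j)" using assms(1) ne by (simp add: seq_dist_def)
  then have "(LEAST j. ?P j) < M" by (subst (asm) power_strict_decreasing_iff) auto
  with k that show thesis by auto
qed

lemma funpow_shift:
  assumes "I = {0..} \<or> I = UNIV" "x \<in> extensional I"
  shows "(shift I ^^ k) x \<in> extensional I \<and> (\<forall>j\<in>I. (shift I ^^ k) x j = x (j + int k))"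
  using assms by (induction k) (auto simp: translate_def algebra_simps)

section \<open>Periodic positions and holes\<close>

text \<open>\<open>Per\<close> only looks forward from \<open>k\<close>, while \<open>k'\<close> may
  lie to its left. The Toeplitz property at \<open>k'\<close> supplies a period \<open>s\<close>
  there; a long enough jump from \<open>k'\<close> by a common multiple of \<open>s\<close> and
  \<open>p\<close> lands on a position that is also reached from \<open>k\<close> by forward steps
  of length \<open>p\<close>.\<close>

lemma Per_cong_value:
  assumes "toeplitz I \<omega>" "k \<in> Per I p \<omega>" "k' \<in> I" "k mod int p = k' mod int p"
  shows "\<omega> k' = \<omega> k"
proof -
  obtain s where s: "s \<ge> 1" "\<And>l::nat. \<omega> (k' + int s * int l) = \<omega> k'"
    using assms(1,3) unfolding toeplitz_def by blast
  obtain c where c: "k = k' + int p * c"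
    using assms(4) by (metis mod_eqE add_diff_cancel_left' add_diff_eq diff_add_cancel)
  \<comment> \<open>The number of steps of length \<open>p\<close> from \<open>k\<close> to
    \<open>k' + s * p * \<bar>c\<bar>\<close>; it is nonnegative because
    \<open>s \<ge> 1\<close>.\<close>
  define l where "l = nat (int s * \<bar>c\<bar> - c)"
  have "\<bar>c\<bar> \<le> int s * \<bar>c\<bar>" using s(1) by (simp add: mult_le_cancel_right1)
  then have l: "int s * \<bar>c\<bar> = int l + c" unfolding l_def by linarith
  have "k' + int s * int (p * nat \<bar>c\<bar>) = k' + int p * (int s * \<bar>c\<bar>)" by simp
  also have "\<dots> = k + int p * int l" unfolding l by (simp add: c algebra_simps)
  finally have "k' + int s * int (p * nat \<bar>c\<bar>) = k + int p * int l" .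
  moreover have "\<omega> (k + int p * int l) = \<omega> k" using assms(2) by (simp add: Per_def)
  ultimately show ?thesis using s(2) by metis
qed

text \<open>Positions congruent to \<open>k\<close> all carry the value at \<open>k\<close>, so
  within \<open>I\<close> the set \<open>Per\<close> is a union of residue classes modulo
  \<open>p\<close>. Hence the holes are determined by those in one period.\<close>

lemma Per_cong:
  assumes I: "I = {0..} \<or> I = UNIV" and T: "toeplitz I \<omega>"
    and k: "k \<in> Per I p \<omega>" "k' \<in> I" "k mod int p = k' mod int p"
  shows "k' \<in> Per I p \<omega>"
proof -
  have "\<omega> (k' + int p * int l) = \<omega> k'" for l :: nat
  proof -
    have "k' + int p * int l \<in> I" using I k(2) by auto
    then have "\<omega> (k' + int p * int l) = \<omega> k"
      using Per_cong_value[OF T k(1)] k(3) by simp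
    also have "\<dots> = \<omega> k'" using Per_cong_value[OF T k] by simp
    finally show ?thesis .
  qed
  with k(2) show ?thesis by (simp add: Per_def)
qed

lemma Per_dvd_mono:
  assumes "p dvd q"
  shows "Per I p \<omega> \<subseteq> Per I q \<omega>"
proof
  fix k assume k: "k \<in> Per I p \<omega>"
  obtain c where c: "q = p * c" using assms by blast
  have "\<omega> (k + int q * int l) = \<omega> k" for l :: nat
  proof -
    have "\<omega> (k + int p * int (c * l)) = \<omega> k" using k unfolding Per_def by blast
    then show ?thesis by (simp add: c mult.assoc)
  qed
  with k show "k \<in> Per I q \<omega>" by (simp add: Per_def)
qed

lemma card_holes:
  assumes "p \<ge> 1"
  shows "real (card ({0..int p - 1} - Per I p \<omega>)) = real p * (1 - per_density I \<omega> p)"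
proof -
  have "card ({0..int p - 1} - Per I p \<omega>)
      = card {0..int p - 1} - card (Per I p \<omega> \<inter> {0..int p - 1})"
    by (subst card_Diff_subset_Int) (auto simp: Int_commute)
  moreover have "card (Per I p \<omega> \<inter> {0..int p - 1}) \<le> card {0..int p - 1}"
    by (intro card_mono) auto
  ultimately show ?thesis using assms
    by (simp add: per_density_def of_nat_diff field_simps)
qed

text \<open>Density 1 would leave no hole in \<open>[0, p - 1]\<close>, hence none in any residue
  class, and \<open>p\<close> would be a period. The strict bound keeps the argument of
  \<open>ln (1 - D)\<close> positive.\<close>

lemma per_density_lt_1:
  assumes I: "I = {0..} \<or> I = UNIV" and T: "toeplitz I \<omega>" and np: "\<not> periodic_seq I \<omega>"
    and p: "p \<ge> 1"
  shows "per_density I \<omega> p < 1"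
proof (rule ccontr)
  assume "\<not> ?thesis"
  then have "real p * (1 - per_density I \<omega> p) \<le> 0" using p by (simp add: mult_le_0_iff)
  then have "card ({0..int p - 1} - Per I p \<omega>) = 0"
    using card_holes[OF p, of I \<omega>] by linarith
  then have sub: "{0..int p - 1} \<subseteq> Per I p \<omega>" by simp
  have "\<omega> (k + int p) = \<omega> k" if "k \<in> I" for k
  proof -
    have "k mod int p \<in> Per I p \<omega>" using sub p by auto
    then have "k \<in> Per I p \<omega>" using Per_cong[OF I T _ that] by simp
    then have "\<omega> (k + int p * int 1) = \<omega> k" unfolding Per_def by blast
    then show ?thesis by simp
  qed
  with np p show False unfolding periodic_seq_def by blast
qed

lemma weak_periodic_structure_unbounded:
  assumes "\<not> periodic_seq I \<omega>" "weak_periodic_structure I \<omega> p"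
  shows "\<exists>l. p l > B"
proof (rule ccontr)
  assume "\<not> ?thesis"
  \<comment> \<open>A bound \<open>B\<close> on all \<open>p l\<close> makes \<open>fact B\<close> a
    common multiple, so every position of \<open>I\<close> would be periodic with this single
    period.\<close>
  then have "p l dvd fact B" for l
    using assms(2) by (intro dvd_fact) (auto simp: weak_periodic_structure_def not_less)
  then have sub: "Per I (p l) \<omega> \<subseteq> Per I (fact B) \<omega>" for l
    by (intro Per_dvd_mono)
  have "\<omega> (k + int (fact B)) = \<omega> k" if "k \<in> I" for k
  proof -
    have "k \<in> Per I (fact B) \<omega>"
      using that sub assms(2) unfolding weak_periodic_structure_def by blast
    then have "\<omega> (k + int (fact B) * int 1) = \<omega> k" unfolding Per_def by blast
    then show ?thesis by simp
  qed
  then have "periodic_seq I \<omega>"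
    unfolding periodic_seq_def by (intro exI[of _ "fact B"]) (auto simp: fact_ge_1)
  with assms(1) show False ..
qed

lemma weak_periodic_structure_dvd:
  assumes "weak_periodic_structure I \<omega> p" "i \<le> j"
  shows "p i dvd p j"
  using assms(2)
proof (induction rule: dec_induct)
  case (step n)
  then show ?case using assms(1) dvd_trans unfolding weak_periodic_structure_def by blast
qed simp

section \<open>Residues of points in the orbit closure\<close>

text \<open>A point of the closure agrees with a translate of \<open>\<omega>\<close> on each
  window, but the translation depends on the window. By the pigeonhole principle one residue modulo
  \<open>p\<close> recurs for infinitely many windows, and restricting larger windows to smaller
  ones makes it serve them all.\<close>

lemma orbit_closure_residue:
  assumes p: "p \<ge> 1" and x: "x \<in> orbit_closure I A \<omega>"
  shows "\<exists>r\<in>{0..<int p}. \<forall>N. \<exists>m\<in>I. m mod int p = r \<and>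
           (\<forall>k\<in>I. nat \<bar>k\<bar> \<le> N \<longrightarrow> x k = \<omega> (k + m))"
proof -
  have "\<exists>m\<in>I. \<forall>k\<in>I. nat \<bar>k\<bar> \<le> N \<longrightarrow> x k = \<omega> (k + m)" for N
  proof -
    have "\<exists>y\<in>{translate I m \<omega> | m. m \<in> I}.
        y \<in> Metric_space.mball (full_shift I A) (seq_dist I) x ((1/2) ^ N)"
      using x unfolding orbit_closure_def
        Metric_space.metric_closure_of[OF Metric_space_full_shift] by auto
    then obtain m where m: "m \<in> I" "seq_dist I x (translate I m \<omega>) < (1/2) ^ N"
      by (auto simp: Metric_space.in_mball[OF Metric_space_full_shift])
    show ?thesis
      using seq_dist_lessD[OF m(2)] m(1) by (intro bexI[of _ m]) (auto simp: translate_def)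
  qed
  then obtain m where m: "\<And>N. m N \<in> I"
    "\<And>N k. k \<in> I \<Longrightarrow> nat \<bar>k\<bar> \<le> N \<Longrightarrow> x k = \<omega> (k + m N)" by metis
  have "range (\<lambda>N. m N mod int p) \<subseteq> {0..<int p}" using p by auto
  then have "finite (range (\<lambda>N. m N mod int p))" by (rule finite_subset) simp
  then obtain N0 where N0: "infinite {N \<in> UNIV. m N mod int p = m N0 mod int p}"
    using pigeonhole_infinite[of "UNIV :: nat set" "\<lambda>N. m N mod int p"] by auto
  have "\<exists>m'\<in>I. m' mod int p = m N0 mod int p \<and> (\<forall>k\<in>I. nat \<bar>k\<bar> \<le> N \<longrightarrow> x k = \<omega> (k + m'))" for N
  proof -
    obtain N' where N': "N' > N" "m N' mod int p = m N0 mod int p"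
      using N0 unfolding infinite_nat_iff_unbounded by auto
    then have "x k = \<omega> (k + m N')" if "k \<in> I" "nat \<bar>k\<bar> \<le> N" for k
      using that m(2)[of k N'] by simp
    with N'(2) m(1) show ?thesis by blast
  qed
  moreover have "m N0 mod int p \<in> {0..<int p}" using p by auto
  ultimately show ?thesis by blast
qed

section \<open>Counting times of separation\<close>

text \<open>The first \<open>n\<close> times meet at most \<open>n div p + 1\<close> blocks of
  length \<open>p\<close>, and each block meets every residue class at most once. The pair of block
  number and shifted residue therefore determines \<open>k\<close>.\<close>

lemma card_residue_le:
  assumes p: "p \<ge> 1" and H: "finite H"
  shows "card {k::nat. k < n \<and> (int k + c) mod int p \<in> H} \<le> (n div p + 1) * card H"
proof -
  let ?K = "{k::nat. k < n \<and> (int k + c) mod int p \<in> H}"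
  let ?f = "\<lambda>k::nat. (k div p, (int k + c) mod int p)"
  have "inj_on ?f ?K"
  proof (rule inj_onI)
    fix a b assume "?f a = ?f b"
    then have d: "a div p = b div p" and "(int a + c) mod int p = (int b + c) mod int p" by auto
    then have "((int a + c) - c) mod int p = ((int b + c) - c) mod int p"
      by (metis mod_diff_left_eq)
    then have "a mod p = b mod p" by (simp flip: of_nat_mod)
    with d show "a = b" by (metis div_mult_mod_eq)
  qed
  moreover have "?f ` ?K \<subseteq> {..n div p} \<times> H" by (auto intro: div_le_mono)
  ultimately have "card ?K \<le> card ({..n div p} \<times> H)"
    using H by (intro card_inj_on_le) auto
  then show ?thesis by (simp add: card_cartesian_product)
qed

text \<open>A union bound over the window: separation at time \<open>k\<close> requires a
  disagreement at \<open>i + k\<close> for some \<open>i\<close> of modulus below \<open>M\<close>,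
  and for each such \<open>i\<close> the admissible times have density at most
  \<open>card H / p\<close>.\<close>

lemma limsup_sep_count_le:
  assumes I: "I = {0..} \<or> I = UNIV" and p: "p \<ge> 1" and H: "finite H"
    and xy: "x \<in> extensional I" "y \<in> extensional I"
    and \<delta>: "(1/2) ^ M < \<delta>"
    and diff: "\<And>k. k \<in> I \<Longrightarrow> x k \<noteq> y k \<Longrightarrow> (k + r) mod int p \<in> H"
  shows "limsup (\<lambda>n. ereal (real (sep_count (seq_dist I) (shift I) \<delta> x y n) / real n))
           \<le> ereal (2 * real M * (real (card H) / real p))"
proof -
  let ?W = "{- int M<..<int M}"
  let ?K = "\<lambda>n i. {k::nat. k < n \<and> (int k + (i + r)) mod int p \<in> H}"
  \<comment> \<open>The second summand accounts for the incomplete last block and vanishes as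
    \<open>n\<close> grows.\<close>
  let ?g = "\<lambda>n. 2 * real M * (real (card H) / real p) + 2 * real M * real (card H) * (1 / real n)"
  have count: "sep_count (seq_dist I) (shift I) \<delta> x y n \<le> (2 * M) * ((n div p + 1) * card H)" for n
  proof -
    have "{k. k < n \<and> seq_dist I ((shift I ^^ k) x) ((shift I ^^ k) y) \<ge> \<delta>} \<subseteq> (\<Union>i\<in>?W. ?K n i)"
    proof
      fix k assume "k \<in> {k. k < n \<and> seq_dist I ((shift I ^^ k) x) ((shift I ^^ k) y) \<ge> \<delta>}"
      then have kn: "k < n" and "(1/2) ^ M < seq_dist I ((shift I ^^ k) x) ((shift I ^^ k) y)"
        using \<delta> by auto
      then obtain i where i: "i \<in> I" "\<bar>i\<bar> < int M" "(shift I ^^ k) x i \<noteq> (shift I ^^ k) y i"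
        using seq_dist_gtE funpow_shift[OF I xy(1)] funpow_shift[OF I xy(2)] by metis
      then have "x (i + int k) \<noteq> y (i + int k)"
        using funpow_shift[OF I xy(1)] funpow_shift[OF I xy(2)] by auto
      moreover have "i + int k \<in> I" using I i(1) by auto
      ultimately have "(i + int k + r) mod int p \<in> H" using diff by blast
      then have "(int k + (i + r)) mod int p \<in> H" by (simp add: algebra_simps)
      moreover have "i \<in> ?W" using i(2) by auto
      ultimately show "k \<in> (\<Union>i\<in>?W. ?K n i)" using kn by blast
    qed
    then have "sep_count (seq_dist I) (shift I) \<delta> x y n \<le> card (\<Union>i\<in>?W. ?K n i)"
      unfolding sep_count_def by (intro card_mono) auto
    also have "\<dots> \<le> (\<Sum>i\<in>?W. card (?K n i))" by (intro card_UN_le) auto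
    also have "\<dots> \<le> (\<Sum>i\<in>?W. (n div p + 1) * card H)"
      by (intro sum_mono card_residue_le p H)
    also have "\<dots> = card ?W * ((n div p + 1) * card H)" by simp
    \<comment> \<open>For positive \<open>M\<close> the window has \<open>2 * M - 1\<close>
      elements, rounded up here; for \<open>M = 0\<close> it is empty.\<close>
    also have "\<dots> \<le> (2 * M) * ((n div p + 1) * card H)"
      by (intro mult_right_mono) auto
    finally show ?thesis .
  qed
  have "real (sep_count (seq_dist I) (shift I) \<delta> x y n) / real n \<le> ?g n" if n: "n \<ge> 1" for n
  proof -
    have "real (sep_count (seq_dist I) (shift I) \<delta> x y n) \<le> real ((2 * M) * ((n div p + 1) * card H))"
      using count by (rule of_nat_mono)
    also have "\<dots> = 2 * real M * ((real (n div p) + 1) * real (card H))" by (simp add: algebra_simps)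
    also have "\<dots> \<le> 2 * real M * ((real n / real p + 1) * real (card H))"
      by (intro mult_left_mono mult_right_mono add_mono of_nat_div_le_of_nat) auto
    finally show ?thesis using n p by (simp add: field_simps)
  qed
  then have "\<forall>\<^sub>F n in sequentially.
      ereal (real (sep_count (seq_dist I) (shift I) \<delta> x y n) / real n) \<le> ereal (?g n)"
    by (intro eventually_sequentiallyI[of 1]) (simp only: ereal_less_eq)
  then have "limsup (\<lambda>n. ereal (real (sep_count (seq_dist I) (shift I) \<delta> x y n) / real n))
      \<le> limsup (\<lambda>n. ereal (?g n))" by (rule Limsup_mono)
  also have "?g \<longlonglongrightarrow> 2 * real M * (real (card H) / real p) + 2 * real M * real (card H) * 0"
    by (intro tendsto_intros lim_1_over_n)
  then have "limsup (\<lambda>n. ereal (?g n)) = ereal (2 * real M * (real (card H) / real p))"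
    by (intro lim_imp_Limsup) auto
  finally show ?thesis .
qed

section \<open>Separated sets have at most \<open>p\<close> points\<close>

text \<open>Distinct points of a separated set must have distinct residues modulo \<open>p\<close>:
  with a common residue they differ only over holes, which is too rare an event for level
  \<open>\<nu>\<close>.\<close>

lemma Sep_le_period:
  assumes I: "I = {0..} \<or> I = UNIV" and T: "toeplitz I \<omega>" and p: "p \<ge> 1"
    and \<delta>: "(1/2) ^ M < \<delta>" and \<nu>: "2 * real M * (1 - per_density I \<omega> p) < \<nu>"
  shows "Sep (orbit_closure I A \<omega>) (seq_dist I) (shift I) \<delta> \<nu> \<le> enat p"
  unfolding Sep_def
proof (rule SUP_least)
  fix S assume "S \<in> {S. S \<subseteq> orbit_closure I A \<omega> \<and> separated_set (seq_dist I) (shift I) \<delta> \<nu> S}"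
  then have S: "S \<subseteq> orbit_closure I A \<omega>" "separated_set (seq_dist I) (shift I) \<delta> \<nu> S" by auto
  let ?H = "{0..int p - 1} - Per I p \<omega>"
  have ext: "x \<in> extensional I" if "x \<in> S" for x
  proof -
    have "x \<in> full_shift I A" using S(1) that
      unfolding orbit_closure_def Metric_space.metric_closure_of[OF Metric_space_full_shift] by auto
    then show ?thesis by (auto simp: full_shift_def PiE_def)
  qed
  obtain r where r: "\<And>x. x \<in> S \<Longrightarrow> r x \<in> {0..<int p}"
    "\<And>x N. x \<in> S \<Longrightarrow> \<exists>m\<in>I. m mod int p = r x \<and> (\<forall>k\<in>I. nat \<bar>k\<bar> \<le> N \<longrightarrow> x k = \<omega> (k + m))"
    using orbit_closure_residue[OF p, of _ I A \<omega>] S(1) by (metis subsetD)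
  have inj: "inj_on r S"
  proof (rule inj_onI, rule ccontr)
    fix x y assume xy: "x \<in> S" "y \<in> S" "r x = r y" "x \<noteq> y"
    have diff: "(k + r x) mod int p \<in> ?H" if k: "k \<in> I" "x k \<noteq> y k" for k
    proof (rule ccontr)
      assume "(k + r x) mod int p \<notin> ?H"
      then have per: "(k + r x) mod int p \<in> Per I p \<omega>" using p by auto
      obtain m where m: "m \<in> I" "m mod int p = r x" "x k = \<omega> (k + m)"
        using r(2)[OF xy(1), of "nat \<bar>k\<bar>"] k(1) by auto
      obtain m' where m': "m' \<in> I" "m' mod int p = r x" "y k = \<omega> (k + m')"
        using r(2)[OF xy(2), of "nat \<bar>k\<bar>"] k(1) xy(3) by auto
      \<comment> \<open>Both translates read \<open>\<omega>\<close> at positions congruent to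
        \<open>k + r x\<close>. This class is periodic, so the two values coincide, against
        \<open>x k \<noteq> y k\<close>.\<close>
      have "k + m \<in> I" "k + m' \<in> I" using I k(1) m(1) m'(1) by auto
      moreover have "(k + r x) mod int p mod int p = (k + m) mod int p"
        "(k + r x) mod int p mod int p = (k + m') mod int p"
        unfolding mod_mod_trivial by (metis m(2) mod_add_right_eq, metis m'(2) mod_add_right_eq)
      ultimately have "\<omega> (k + m) = \<omega> (k + m')"
        using Per_cong_value[OF T per] by metis
      with k m m' show False by simp
    qed
    have "ereal \<nu> \<le> limsup (\<lambda>n. ereal (real (sep_count (seq_dist I) (shift I) \<delta> x y n) / real n))"
      using S(2) xy unfolding separated_set_def separated_points_def by blast
    also have "\<dots> \<le> ereal (2 * real M * (real (card ?H) / real p))"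
      using limsup_sep_count_le[OF I p _ ext[OF xy(1)] ext[OF xy(2)] \<delta> diff] by simp
    also have "real (card ?H) / real p = 1 - per_density I \<omega> p"
      unfolding card_holes[OF p] using p by simp
    finally show False using \<nu> by simp
  qed
  have img: "r ` S \<subseteq> {0..<int p}" using r(1) by auto
  have "finite S" using inj img by (meson finite_atLeastLessThan_int finite_imageD finite_subset)
  moreover have "card S \<le> p" using card_inj_on_le[OF inj img] by simp
  ultimately show "ecard S \<le> enat p" by (simp add: ecard_def)
qed

section \<open>From separation numbers to the upper amorphic complexity\<close>

lemma eln_le:
  assumes "N \<le> enat p" "p \<ge> 1"
  shows "eln N \<le> ereal (ln (real p))"
  using assms by (cases N) (auto simp: eln_def)

theorem theorem1p6:
  fixes I :: "int set" and A :: "'a set" and \<omega> :: "int \<Rightarrow> 'a" and p :: "nat \<Rightarrow> nat"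
  assumes "I = {0..} \<or> I = UNIV"
    and "finite A"
    and "\<omega> \<in> full_shift I A"
    and "regular_toeplitz I \<omega>"
    and "\<not> periodic_seq I \<omega>"
    and "weak_periodic_structure I \<omega> p"
  shows "upper_ac (orbit_closure I A \<omega>) (seq_dist I) (shift I)
           \<le> limsup (\<lambda>l. ereal (ln (real (p (Suc l))) / - ln (1 - per_density I \<omega> (p l))))"
proof (rule dense_ge)
  note I = assms(1) and wps = assms(6)
  let ?D = "\<lambda>l. per_density I \<omega> (p l)"
  let ?t = "\<lambda>l. ln (real (p (Suc l))) / - ln (1 - ?D l)"
  let ?ac = "upper_ac (orbit_closure I A \<omega>) (seq_dist I) (shift I)"
  have T: "toeplitz I \<omega>" using assms(4) by (simp add: regular_toeplitz_def)
  have p1: "p l \<ge> 1" for l using wps by (simp add: weak_periodic_structure_def)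
  have D1: "?D l < 1" for l by (rule per_density_lt_1[OF I T assms(5) p1])
  have "0 \<in> I" using I by auto
  then have "0 \<in> (\<Union>l. Per I (p l) \<omega>)" using wps by (simp add: weak_periodic_structure_def)
  then obtain l0 where l0: "0 \<in> Per I (p l0) \<omega>" by blast
  \<comment> \<open>Once position 0 is periodic it stays so along the structure. Positive density
    makes \<open>- ln (1 - ?D l)\<close> positive, so the quotient \<open>?t l\<close> can be
    cleared of its denominator.\<close>
  have Dpos: "?D l > 0" if "l \<ge> l0" for l
  proof -
    have "0 \<in> Per I (p l) \<omega> \<inter> {0..int (p l) - 1}"
      using l0 Per_dvd_mono[OF weak_periodic_structure_dvd[OF wps that]] p1[of l] by auto
    then have "card (Per I (p l) \<omega> \<inter> {0..int (p l) - 1}) > 0" by (subst card_gt_0_iff) auto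
    then show ?thesis using p1[of l] by (simp add: per_density_def)
  qed
  fix b :: ereal assume b: "limsup (\<lambda>l. ereal (?t l)) < b"
  show "?ac \<le> b"
  proof (cases b)
    case (real s)
    have "\<forall>\<^sub>F l in sequentially. ?t l < s" using Limsup_lessD[OF b] real by simp
    then obtain L0 where L0: "\<And>l. l \<ge> L0 \<Longrightarrow> ?t l < s" by (auto simp: eventually_sequentially)
    define L where "L = max L0 l0"
    have lnD: "- ln (1 - ?D l) > 0" if "l \<ge> L" for l
      using Dpos[of l] D1[of l] that by (simp add: L_def ln_less_zero)
    have "0 \<le> ?t L" using lnD[of L] p1[of "Suc L"] by (intro divide_nonneg_pos) auto
    then have s: "s > 0" using L0[of L] by (simp add: L_def)
    have lnp: "ln (real (p (Suc l))) < s * - ln (1 - ?D l)" if "l \<ge> L" for l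
      using L0[of l] that unfolding pos_divide_less_eq[OF lnD[OF that]] by (simp add: L_def)
    \<comment> \<open>The periods are unbounded, and \<open>lnp\<close> bounds
      \<open>ln (p (Suc l))\<close> by \<open>s * - ln (1 - ?D l)\<close>; a large next period
      therefore forces a small hole density.\<close>
    have small: "\<exists>l\<ge>L. 1 - ?D l < \<epsilon>" if \<epsilon>: "\<epsilon> > 0" for \<epsilon>
    proof -
      obtain B :: nat where B: "B > exp (s * - ln \<epsilon>)" using reals_Archimedean2 by blast
      obtain l where l: "p l > B" using weak_periodic_structure_unbounded[OF assms(5) wps] by blast
      have "p l \<le> p (Suc (max l L))"
        using p1[of "Suc (max l L)"] weak_periodic_structure_dvd[OF wps, of l "Suc (max l L)"]
        by (intro dvd_imp_le) auto
      then have "real (p (Suc (max l L))) > exp (s * - ln \<epsilon>)" using l B by linarith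
      then have "ln (exp (s * - ln \<epsilon>)) < ln (real (p (Suc (max l L))))"
        using p1[of "Suc (max l L)"] by (subst ln_less_cancel_iff) auto
      then have "s * - ln \<epsilon> < ln (real (p (Suc (max l L))))" by simp
      also have "\<dots> < s * - ln (1 - ?D (max l L))" by (rule lnp) simp
      finally have "ln (1 - ?D (max l L)) < ln \<epsilon>" using s by simp
      then show ?thesis using \<epsilon> D1[of "max l L"] by (intro exI[of _ "max l L"]) simp
    qed
    have "Limsup (at_right 0)
        (\<lambda>\<nu>. eln (Sep (orbit_closure I A \<omega>) (seq_dist I) (shift I) \<delta> \<nu>) / ereal (- ln \<nu>)) \<le> b"
      if \<delta>: "\<delta> > 0" for \<delta>
    proof -
      let ?Sep = "Sep (orbit_closure I A \<omega>) (seq_dist I) (shift I) \<delta>"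
      obtain M0 where M0: "(1/2::real) ^ M0 < \<delta>" using real_arch_pow_inv[OF \<delta>] by fastforce
      \<comment> \<open>The successor makes \<open>M\<close> positive, so that \<open>C\<close> can
        be divided by and has a logarithm.\<close>
      define M where "M = Suc M0"
      have M: "(1/2::real) ^ M < \<delta>" using M0 \<delta> by (simp add: M_def)
      define C where "C = 2 * real M"
      have C: "C > 0" by (simp add: C_def M_def)
      have bound: "eln (?Sep \<nu>) / ereal (- ln \<nu>) \<le> ereal (s + s * ln C * inverse (- ln \<nu>))"
        if \<nu>: "0 < \<nu>" "\<nu> < 1" "\<nu> < C * (1 - ?D L)" for \<nu>
      proof -
        let ?Q = "\<lambda>l. l \<ge> L \<and> C * (1 - ?D l) < \<nu>"
        \<comment> \<open>The first index from \<open>L\<close> on whose hole density is small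
          enough for \<open>Sep_le_period\<close>. As \<open>\<nu> < C * (1 - ?D L)\<close>, it is
          not \<open>L\<close> itself; its predecessor \<open>j\<close> violates the condition,
          which bounds \<open>1 - ?D j\<close> below by \<open>\<nu> / C\<close>. Together with
          \<open>lnp\<close> at \<open>j\<close> this controls \<open>ln (p l)\<close>.\<close>
        define l where "l = (LEAST l. ?Q l)"
        have "\<exists>l. ?Q l" using small[of "\<nu> / C"] \<nu> C by (auto simp: field_simps)
        then have l: "?Q l" unfolding l_def by (rule LeastI_ex)
        then have "l \<noteq> L" using \<nu> by auto
        then obtain j where j: "l = Suc j" "j \<ge> L" using l by (cases l) auto
        then have "\<not> ?Q j" using not_less_Least[of j ?Q] by (simp add: l_def)
        then have "\<nu> / C \<le> 1 - ?D j" using j C by (simp add: field_simps)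
        then have "ln (\<nu> / C) \<le> ln (1 - ?D j)" using \<nu> C D1[of j] by simp
        then have ge: "ln \<nu> - ln C \<le> ln (1 - ?D j)" using \<nu> C by (simp add: ln_div)
        have "ln (real (p l)) < s * - ln (1 - ?D j)" using lnp[OF j(2)] j(1) by simp
        also have "\<dots> \<le> s * (ln C - ln \<nu>)" using ge s by (intro mult_left_mono) auto
        finally have lnpl: "ln (real (p l)) \<le> s * (ln C - ln \<nu>)" by simp
        have "?Sep \<nu> \<le> enat (p l)" using l by (intro Sep_le_period[OF I T p1 M]) (simp add: C_def)
        then have "eln (?Sep \<nu>) \<le> ereal (ln (real (p l)))" using p1 by (rule eln_le)
        also have "\<dots> \<le> ereal (s * (ln C - ln \<nu>))" using lnpl by simp
        finally have "eln (?Sep \<nu>) / ereal (- ln \<nu>) \<le> ereal (s * (ln C - ln \<nu>)) / ereal (- ln \<nu>)"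
          using \<nu> by (intro ereal_divide_right_mono) auto
        also have "\<dots> = ereal (s + s * ln C * inverse (- ln \<nu>))"
          using \<nu> by (simp add: field_simps)
        finally show ?thesis .
      qed
      have "\<forall>\<^sub>F \<nu> in at_right 0. 0 < \<nu> \<and> \<nu> < min 1 (C * (1 - ?D L))"
        using C D1[of L] by (intro eventually_conj eventually_at_right_less
          order_tendstoD(2)[OF tendsto_ident_at]) auto
      then have "\<forall>\<^sub>F \<nu> in at_right 0.
          eln (?Sep \<nu>) / ereal (- ln \<nu>) \<le> ereal (s + s * ln C * inverse (- ln \<nu>))"
        by eventually_elim (use bound in auto)
      then have "Limsup (at_right 0) (\<lambda>\<nu>. eln (?Sep \<nu>) / ereal (- ln \<nu>))
          \<le> Limsup (at_right 0) (\<lambda>\<nu>. ereal (s + s * ln C * inverse (- ln \<nu>)))"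
        by (rule Limsup_mono)
      \<comment> \<open>Since \<open>- ln \<nu>\<close> tends to infinity, the window constant
        \<open>C\<close>, and with it the dependence on \<open>\<delta>\<close>, disappears in the
        limit.\<close>
      also have "((\<lambda>\<nu>. inverse (- ln \<nu>)) \<longlongrightarrow> (0::real)) (at_right 0)"
        by (intro tendsto_inverse_0_at_top filterlim_uminus_at_top_at_bot[THEN filterlim_compose] ln_at_0)
      then have "((\<lambda>\<nu>. s + s * ln C * inverse (- ln \<nu>)) \<longlongrightarrow> s + s * ln C * 0) (at_right 0)"
        by (intro tendsto_intros)
      then have "Limsup (at_right 0) (\<lambda>\<nu>. ereal (s + s * ln C * inverse (- ln \<nu>))) = ereal s"
        by (intro lim_imp_Limsup) auto
      finally show ?thesis using real by simp
    qed
    then show ?thesis unfolding upper_ac_def by (intro SUP_least) auto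
  qed (use b in auto)
qed

end
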